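(* Let $X$ be a complex Banach space with open unit ball $B_X$, and let $\varphi:B_X\to B_X$ be holomorphic such that $\varphi(B_X)\subseteq rB_X$ for some $0<r<1$ and $\varphi(0)=0$. Then $C_{\varphi^n}\to C_0$ as $n\to\infty$ in the norm operator topology of $L(H^\infty(B_X))$. In particular, $(C_\varphi)_{[n]}\to C_0$, and $C_\varphi:H^\infty(B_X)\to H^\infty(B_X)$ is uniformly mean ergodic.
   Context: A function is holomorphic if it is (complex) Fréchet differentiable at every point. $H^\infty(B_X)$ is the Banach space of all bounded holomorphic functions $f:B_X\to\mathbb{C}$ with norm $\|f\|_\infty=\sup_{x\in B_X}|f(x)|$. $C_\psi(f)=f\circ\psi$ denotes the composition operator with symbol $\psi$, $\varphi^n$ is the $n$-th iterate of $\varphi$, and $C_0$ is the composition operator whose symbol is the constant function $0$, i.e. $C_0(f)$ is the constant function $f(0)$. For a Banach space $E$, $L(E)$ is the space of continuous linear maps $E\to E$ and, for $T\in L(E)$, $T_{[n]}=\frac1n\sum_{k=0}^{n-1}T^k$ ($T^0=\mathrm{id}$). $T$ is uniformly mean ergodic if $(T_{[n]})_n$ converges in $L(E)$ uniformly on bounded subsets of $E$, i.e. in operator norm. *)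

theory Defs
  imports "HOL-Analysis.Analysis"
begin

section \<open>Complex normed and Banach spaces\<close>

text \<open>The distribution only has real normed spaces. A complex one is a real one with a complex
  scalar multiplication that extends the real one and for which the norm is homogeneous.\<close>

class scaleC =
  fixes scaleC :: "complex \<Rightarrow> 'a \<Rightarrow> 'a"  (infixr "*\<^sub>C" 75)

class complex_normed_vector = real_normed_vector + scaleC +
  assumes scaleC_add_right: "a *\<^sub>C (x + y) = a *\<^sub>C x + a *\<^sub>C y"
    and scaleC_add_left: "(a + b) *\<^sub>C x = a *\<^sub>C x + b *\<^sub>C x"
    and scaleC_scaleC: "a *\<^sub>C (b *\<^sub>C x) = (a * b) *\<^sub>C x"
    and scaleR_scaleC: "r *\<^sub>R x = complex_of_real r *\<^sub>C x"
    and norm_scaleC: "norm (a *\<^sub>C x) = cmod a * norm x"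

class complex_banach = complex_normed_vector + banach

instantiation complex :: complex_banach
begin

definition scaleC_complex_def [simp]: "scaleC a (x::complex) = a * x"

instance
  by standard (simp_all add: algebra_simps norm_mult scaleR_conv_of_real)

end

section \<open>Continuous complex-linear operators\<close>

text \<open>\<open>('a, 'b) cblinfun\<close> is the space of continuous complex-linear maps, with the operator norm
  inherited from the library type of continuous real-linear maps.\<close>

typedef (overloaded) ('a::complex_normed_vector, 'b::complex_normed_vector) cblinfun
    (\<open>(_ \<Rightarrow>\<^sub>C\<^sub>L /_)\<close> [22, 21] 21) =
  "{T :: 'a \<Rightarrow>\<^sub>L 'b. \<forall>c x. blinfun_apply T (c *\<^sub>C x) = c *\<^sub>C blinfun_apply T x}"
  morphisms blinfun_of_cblinfun cblinfun_of_blinfun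
proof -
  have "0 = (c *\<^sub>C 0 :: 'b)" for c
    using norm_scaleC[of c "0::'b"] by simp
  then show ?thesis
    by (intro exI[of _ 0]) simp
qed

setup_lifting type_definition_cblinfun

lemma scaleC_zero_right: "c *\<^sub>C (0::'a::complex_normed_vector) = 0"
  using norm_scaleC[of c "0::'a"] by simp

lemma scaleC_minus_right: "c *\<^sub>C (- x) = - (c *\<^sub>C (x::'a::complex_normed_vector))"
  using scaleC_add_right[of c x "- x"] by (simp add: scaleC_zero_right eq_neg_iff_add_eq_0 add.commute)

lemma scaleC_diff_right: "c *\<^sub>C (x - y) = c *\<^sub>C x - c *\<^sub>C (y::'a::complex_normed_vector)"
  using scaleC_add_right[of c x "- y"] by (simp add: scaleC_minus_right)

lemma scaleC_scaleR_commute: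
  "c *\<^sub>C (r *\<^sub>R x) = r *\<^sub>R (c *\<^sub>C (x::'a::complex_normed_vector))"
  by (simp add: scaleR_scaleC scaleC_scaleC mult.commute)

instantiation cblinfun :: (complex_normed_vector, complex_normed_vector) real_normed_vector
begin

lift_definition zero_cblinfun :: "'a \<Rightarrow>\<^sub>C\<^sub>L 'b" is 0
  by (simp add: scaleC_zero_right)

lift_definition plus_cblinfun :: "('a \<Rightarrow>\<^sub>C\<^sub>L 'b) \<Rightarrow> ('a \<Rightarrow>\<^sub>C\<^sub>L 'b) \<Rightarrow> 'a \<Rightarrow>\<^sub>C\<^sub>L 'b" is "(+)"
  by (simp add: blinfun.add_left scaleC_add_right)

lift_definition minus_cblinfun :: "('a \<Rightarrow>\<^sub>C\<^sub>L 'b) \<Rightarrow> ('a \<Rightarrow>\<^sub>C\<^sub>L 'b) \<Rightarrow> 'a \<Rightarrow>\<^sub>C\<^sub>L 'b" is "(-)"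
  by (simp add: blinfun.diff_left scaleC_diff_right)

lift_definition uminus_cblinfun :: "('a \<Rightarrow>\<^sub>C\<^sub>L 'b) \<Rightarrow> 'a \<Rightarrow>\<^sub>C\<^sub>L 'b" is uminus
  by (simp add: blinfun.minus_left scaleC_minus_right)

lift_definition scaleR_cblinfun :: "real \<Rightarrow> ('a \<Rightarrow>\<^sub>C\<^sub>L 'b) \<Rightarrow> 'a \<Rightarrow>\<^sub>C\<^sub>L 'b" is scaleR
  by (simp add: blinfun.scaleR_left scaleC_scaleR_commute)

lift_definition norm_cblinfun :: "('a \<Rightarrow>\<^sub>C\<^sub>L 'b) \<Rightarrow> real" is norm .

definition dist_cblinfun :: "('a \<Rightarrow>\<^sub>C\<^sub>L 'b) \<Rightarrow> ('a \<Rightarrow>\<^sub>C\<^sub>L 'b) \<Rightarrow> real"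
  where "dist_cblinfun S T = norm (S - T)"

definition sgn_cblinfun :: "('a \<Rightarrow>\<^sub>C\<^sub>L 'b) \<Rightarrow> 'a \<Rightarrow>\<^sub>C\<^sub>L 'b"
  where "sgn_cblinfun T = inverse (norm T) *\<^sub>R T"

definition uniformity_cblinfun :: "(('a \<Rightarrow>\<^sub>C\<^sub>L 'b) \<times> ('a \<Rightarrow>\<^sub>C\<^sub>L 'b)) filter"
  where "uniformity_cblinfun = (INF e\<in>{0<..}. principal {(S, T). dist S T < e})"

definition open_cblinfun :: "('a \<Rightarrow>\<^sub>C\<^sub>L 'b) set \<Rightarrow> bool"
  where "open_cblinfun U = (\<forall>S\<in>U. \<forall>\<^sub>F (S', T) in uniformity. S' = S \<longrightarrow> T \<in> U)"

instance
proof
  fix S T R :: "'a \<Rightarrow>\<^sub>C\<^sub>L 'b" and a b :: real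
  show "S + T + R = S + (T + R)" by transfer (rule add.assoc)
  show "S + T = T + S" by transfer (rule add.commute)
  show "0 + S = S" by transfer simp
  show "- S + S = 0" by transfer simp
  show "S - T = S + - T" by transfer simp
  show "a *\<^sub>R (S + T) = a *\<^sub>R S + a *\<^sub>R T" by transfer (rule scaleR_add_right)
  show "(a + b) *\<^sub>R S = a *\<^sub>R S + b *\<^sub>R S" by transfer (rule scaleR_add_left)
  show "a *\<^sub>R b *\<^sub>R S = (a * b) *\<^sub>R S" by transfer simp
  show "1 *\<^sub>R S = S" by transfer simp
  show "(norm S = 0) = (S = 0)" by transfer simp
  show "norm (S + T) \<le> norm S + norm T" by transfer (rule norm_triangle_ineq)
  show "norm (a *\<^sub>R S) = \<bar>a\<bar> * norm S" by transfer simp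
qed (simp_all add: dist_cblinfun_def sgn_cblinfun_def uniformity_cblinfun_def open_cblinfun_def)

end

definition cblinfun_apply :: "('a::complex_normed_vector \<Rightarrow>\<^sub>C\<^sub>L 'b::complex_normed_vector) \<Rightarrow> 'a \<Rightarrow> 'b"
  where "cblinfun_apply T = blinfun_apply (blinfun_of_cblinfun T)"

lift_definition id_cblinfun :: "'a::complex_normed_vector \<Rightarrow>\<^sub>C\<^sub>L 'a" is id_blinfun
  by simp

lift_definition cblinfun_compose ::
  "('b::complex_normed_vector \<Rightarrow>\<^sub>C\<^sub>L 'c::complex_normed_vector) \<Rightarrow>
    ('a::complex_normed_vector \<Rightarrow>\<^sub>C\<^sub>L 'b) \<Rightarrow> 'a \<Rightarrow>\<^sub>C\<^sub>L 'c"
  is blinfun_compose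
  by simp

lemma cblinfun_ext: "(\<And>x. cblinfun_apply S x = cblinfun_apply T x) \<Longrightarrow> S = T"
  by (simp add: cblinfun_apply_def blinfun_eqI blinfun_of_cblinfun_inject[symmetric])

lemma norm_cblinfun_onorm: "norm T = onorm (cblinfun_apply T)"
  by (simp add: cblinfun_apply_def norm_cblinfun.rep_eq norm_blinfun.rep_eq)

lemma id_cblinfun_apply [simp]: "cblinfun_apply id_cblinfun x = x"
  by (simp add: cblinfun_apply_def id_cblinfun.rep_eq)

lemma cblinfun_compose_apply [simp]:
  "cblinfun_apply (cblinfun_compose S T) x = cblinfun_apply S (cblinfun_apply T x)"
  by (simp add: cblinfun_apply_def cblinfun_compose.rep_eq)

lemma ex_cblinfun:
  fixes F :: "'a::complex_normed_vector \<Rightarrow> 'b::complex_normed_vector"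
  assumes "bounded_linear F" and "\<And>c x. F (c *\<^sub>C x) = c *\<^sub>C F x"
  shows "\<exists>T. cblinfun_apply T = F"
proof
  show "cblinfun_apply (cblinfun_of_blinfun (Blinfun F)) = F"
    using assms
    by (simp add: cblinfun_apply_def cblinfun_of_blinfun_inverse bounded_linear_Blinfun_apply)
qed

definition cblinfun_power :: "('a::complex_normed_vector \<Rightarrow>\<^sub>C\<^sub>L 'a) \<Rightarrow> nat \<Rightarrow> 'a \<Rightarrow>\<^sub>C\<^sub>L 'a"
  where "cblinfun_power T k = (cblinfun_compose T ^^ k) id_cblinfun"

lemma cblinfun_power_apply: "cblinfun_apply (cblinfun_power T k) x = (cblinfun_apply T ^^ k) x"
  by (induction k) (simp_all add: cblinfun_power_def)

text \<open>For \<open>n = 0\<close> the mean below is \<open>0\<close>, which is irrelevant for limits.\<close>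

definition cesaro_mean :: "('a::complex_normed_vector \<Rightarrow>\<^sub>C\<^sub>L 'a) \<Rightarrow> nat \<Rightarrow> 'a \<Rightarrow>\<^sub>C\<^sub>L 'a"
  where "cesaro_mean T n = (1 / real n) *\<^sub>R (\<Sum>k<n. cblinfun_power T k)"

definition uniformly_mean_ergodic :: "('a::complex_normed_vector \<Rightarrow>\<^sub>C\<^sub>L 'a) \<Rightarrow> bool"
  where "uniformly_mean_ergodic T \<longleftrightarrow> convergent (cesaro_mean T)"

section \<open>Holomorphic functions and \<open>H\<^sup>\<infinity>\<close> of the unit ball\<close>

text \<open>Complex Frechet differentiability: the real Frechet derivative exists and is complex-linear.
  The filter \<open>at x\<close> is unrestricted, so this is meant for open sets.\<close>

definition frechet_holomorphic_on ::
  "('a::complex_normed_vector \<Rightarrow> 'b::complex_normed_vector) \<Rightarrow> 'a set \<Rightarrow> bool"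
  where "frechet_holomorphic_on f S \<longleftrightarrow>
    (\<forall>x\<in>S. \<exists>D. (f has_derivative D) (at x) \<and> (\<forall>c v. D (c *\<^sub>C v) = c *\<^sub>C D v))"

lemma frechet_holomorphic_onI:
  assumes "\<And>x. x \<in> S \<Longrightarrow> (f has_derivative D x) (at x)"
    and "\<And>x c v. x \<in> S \<Longrightarrow> D x (c *\<^sub>C v) = c *\<^sub>C D x v"
  shows "frechet_holomorphic_on f S"
  unfolding frechet_holomorphic_on_def
proof
  fix x assume "x \<in> S"
  with assms show "\<exists>D. (f has_derivative D) (at x) \<and> (\<forall>c v. D (c *\<^sub>C v) = c *\<^sub>C D v)"
    by (intro exI[of _ "D x"]) simp
qed

lemma frechet_holomorphic_onE:
  assumes "frechet_holomorphic_on f S"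
  obtains D where "\<And>x. x \<in> S \<Longrightarrow> (f has_derivative D x) (at x)"
    and "\<And>x c v. x \<in> S \<Longrightarrow> D x (c *\<^sub>C v) = c *\<^sub>C D x v"
proof -
  from bchoice[OF assms[unfolded frechet_holomorphic_on_def]] that show ?thesis
    by blast
qed

lemma frechet_holomorphic_on_complex_iff:
  assumes "open S"
  shows "frechet_holomorphic_on (f :: complex \<Rightarrow> complex) S \<longleftrightarrow> f holomorphic_on S"
proof -
  have iff: "(\<exists>D. (f has_derivative D) (at x) \<and> (\<forall>c v. D (c * v) = c * D v)) \<longleftrightarrow>
      f field_differentiable at x" for x
  proof
    assume "\<exists>D. (f has_derivative D) (at x) \<and> (\<forall>c v. D (c * v) = c * D v)"
    then obtain D where D: "(f has_derivative D) (at x)" "\<And>c v. D (c * v) = c * D v" by blast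
    have "D = (*) (D 1)"
    proof
      fix c show "D c = D 1 * c"
        using D(2)[of c 1] by (simp add: mult.commute)
    qed
    with D(1) have "(f has_derivative (*) (D 1)) (at x)" by simp
    then show "f field_differentiable at x"
      unfolding field_differentiable_def has_field_derivative_def by (rule exI)
  next
    assume "f field_differentiable at x"
    then obtain d where "(f has_derivative (*) d) (at x)"
      unfolding field_differentiable_def has_field_derivative_def by blast
    then show "\<exists>D. (f has_derivative D) (at x) \<and> (\<forall>c v. D (c * v) = c * D v)"
      by (intro exI[of _ "(*) d"]) (simp add: mult.left_commute)
  qed
  show ?thesis
    unfolding frechet_holomorphic_on_def holomorphic_on_def scaleC_complex_def iff
    by (rule ball_cong[OF refl]) (simp only: at_within_open[OF _ assms])
qed

lemma frechet_holomorphic_on_cong: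
  assumes "open S" and "frechet_holomorphic_on f S" and "\<And>x. x \<in> S \<Longrightarrow> f x = g x"
  shows "frechet_holomorphic_on g S"
proof -
  obtain D where D: "\<And>x. x \<in> S \<Longrightarrow> (f has_derivative D x) (at x)"
    "\<And>x c v. x \<in> S \<Longrightarrow> D x (c *\<^sub>C v) = c *\<^sub>C D x v"
    using assms(2) by (rule frechet_holomorphic_onE) blast
  show ?thesis
  proof (rule frechet_holomorphic_onI[of _ _ D])
    fix x c v assume x: "x \<in> S"
    show "(g has_derivative D x) (at x)"
      by (rule has_derivative_transform_within_open[OF D(1)[OF x] assms(1) x assms(3)])
    show "D x (c *\<^sub>C v) = c *\<^sub>C D x v"
      by (rule D(2)[OF x])
  qed
qed

lemma frechet_holomorphic_on_const: "frechet_holomorphic_on (\<lambda>_. c) S"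
  by (rule frechet_holomorphic_onI[of _ _ "\<lambda>_ _. 0"]) (simp_all add: scaleC_zero_right)

lemma frechet_holomorphic_on_add:
  assumes "frechet_holomorphic_on f S" and "frechet_holomorphic_on g S"
  shows "frechet_holomorphic_on (\<lambda>x. f x + g x) S"
proof -
  obtain F where F: "\<And>x. x \<in> S \<Longrightarrow> (f has_derivative F x) (at x)"
    "\<And>x c v. x \<in> S \<Longrightarrow> F x (c *\<^sub>C v) = c *\<^sub>C F x v"
    using assms(1) by (rule frechet_holomorphic_onE) blast
  obtain G where G: "\<And>x. x \<in> S \<Longrightarrow> (g has_derivative G x) (at x)"
    "\<And>x c v. x \<in> S \<Longrightarrow> G x (c *\<^sub>C v) = c *\<^sub>C G x v"
    using assms(2) by (rule frechet_holomorphic_onE) blast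
  show ?thesis
  proof (rule frechet_holomorphic_onI[of _ _ "\<lambda>x v. F x v + G x v"])
    fix x c v assume x: "x \<in> S"
    show "((\<lambda>x. f x + g x) has_derivative (\<lambda>v. F x v + G x v)) (at x)"
      by (rule has_derivative_add[OF F(1)[OF x] G(1)[OF x]])
    show "F x (c *\<^sub>C v) + G x (c *\<^sub>C v) = c *\<^sub>C (F x v + G x v)"
      by (simp only: F(2)[OF x] G(2)[OF x] scaleC_add_right)
  qed
qed

lemma frechet_holomorphic_on_cmult:
  fixes f :: "'a::complex_normed_vector \<Rightarrow> complex"
  assumes "frechet_holomorphic_on f S"
  shows "frechet_holomorphic_on (\<lambda>x. a * f x) S"
proof -
  obtain F where F: "\<And>x. x \<in> S \<Longrightarrow> (f has_derivative F x) (at x)"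
    "\<And>x c v. x \<in> S \<Longrightarrow> F x (c *\<^sub>C v) = c *\<^sub>C F x v"
    using assms by (rule frechet_holomorphic_onE) blast
  show ?thesis
  proof (rule frechet_holomorphic_onI[of _ _ "\<lambda>x v. a * F x v"])
    fix x c v assume x: "x \<in> S"
    show "((\<lambda>x. a * f x) has_derivative (\<lambda>v. a * F x v)) (at x)"
      by (rule has_derivative_mult_right[OF F(1)[OF x]])
    show "a * F x (c *\<^sub>C v) = c *\<^sub>C (a * F x v)"
      by (simp add: F(2)[OF x])
  qed
qed

lemma frechet_holomorphic_on_compose:
  assumes "frechet_holomorphic_on g S" and "g ` S \<subseteq> T" and "frechet_holomorphic_on f T"
  shows "frechet_holomorphic_on (\<lambda>x. f (g x)) S"
proof -
  obtain G where G: "\<And>x. x \<in> S \<Longrightarrow> (g has_derivative G x) (at x)"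
    "\<And>x c v. x \<in> S \<Longrightarrow> G x (c *\<^sub>C v) = c *\<^sub>C G x v"
    using assms(1) by (rule frechet_holomorphic_onE) blast
  obtain F where F: "\<And>x. x \<in> T \<Longrightarrow> (f has_derivative F x) (at x)"
    "\<And>x c v. x \<in> T \<Longrightarrow> F x (c *\<^sub>C v) = c *\<^sub>C F x v"
    using assms(3) by (rule frechet_holomorphic_onE) blast
  show ?thesis
  proof (rule frechet_holomorphic_onI[of _ _ "\<lambda>x v. F (g x) (G x v)"])
    fix x c v assume x: "x \<in> S"
    then have gx: "g x \<in> T" using assms(2) by blast
    show "((\<lambda>x. f (g x)) has_derivative (\<lambda>v. F (g x) (G x v))) (at x)"
      by (rule has_derivative_compose[OF G(1)[OF x] F(1)[OF gx]])
    show "F (g x) (G x (c *\<^sub>C v)) = c *\<^sub>C F (g x) (G x v)"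
      by (simp only: G(2)[OF x] F(2)[OF gx])
  qed
qed

text \<open>Elements of \<open>H\<^sup>\<infinity>\<close> are total functions; setting them to \<open>0\<close> off the open unit ball makes
  equality of elements the same as equality on the ball.\<close>

typedef (overloaded) 'a hinf =
  "{f :: 'a::complex_normed_vector \<Rightarrow> complex.
      frechet_holomorphic_on f (ball 0 1) \<and> bounded (f ` ball 0 1) \<and> (\<forall>x. x \<notin> ball 0 1 \<longrightarrow> f x = 0)}"
  morphisms hinf_apply Abs_hinf
  by (rule exI[of _ "\<lambda>_. 0"]) (simp add: frechet_holomorphic_on_const image_constant_conv)

setup_lifting type_definition_hinf

lemma hinf_ext:
  assumes "\<And>x. x \<in> ball 0 1 \<Longrightarrow> hinf_apply f x = hinf_apply g x"
  shows "f = g"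
proof -
  have "hinf_apply f x = hinf_apply g x" for x
    using assms[of x] hinf_apply[of f] hinf_apply[of g] by (cases "x \<in> ball 0 1") simp_all
  then show ?thesis
    by (simp add: hinf_apply_inject[symmetric] fun_eq_iff)
qed

lemma bounded_cmult_image:
  fixes f :: "'a \<Rightarrow> complex"
  assumes "bounded (f ` S)"
  shows "bounded ((\<lambda>x. c * f x) ` S)"
proof -
  have "bounded ((*) c ` f ` S)"
    using assms bounded_linear_mult_right by (rule bounded_linear_image)
  then show ?thesis by (simp only: image_image)
qed

instantiation hinf :: (complex_normed_vector) complex_normed_vector
begin

lift_definition zero_hinf :: "'a hinf" is "\<lambda>_. 0"
  by (simp add: frechet_holomorphic_on_const image_constant_conv)

lift_definition plus_hinf :: "'a hinf \<Rightarrow> 'a hinf \<Rightarrow> 'a hinf" is "\<lambda>f g x. f x + g x"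
  by (simp add: frechet_holomorphic_on_add bounded_plus_comp)

lift_definition scaleC_hinf :: "complex \<Rightarrow> 'a hinf \<Rightarrow> 'a hinf" is "\<lambda>c f x. c * f x"
  by (simp add: frechet_holomorphic_on_cmult bounded_cmult_image)

definition uminus_hinf :: "'a hinf \<Rightarrow> 'a hinf" where "uminus_hinf f = (- 1) *\<^sub>C f"

definition minus_hinf :: "'a hinf \<Rightarrow> 'a hinf \<Rightarrow> 'a hinf" where "minus_hinf f g = f + - g"

definition scaleR_hinf :: "real \<Rightarrow> 'a hinf \<Rightarrow> 'a hinf"
  where "scaleR_hinf r f = complex_of_real r *\<^sub>C f"

definition norm_hinf :: "'a hinf \<Rightarrow> real"
  where "norm_hinf f = (SUP x\<in>ball 0 1. cmod (hinf_apply f x))"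

definition dist_hinf :: "'a hinf \<Rightarrow> 'a hinf \<Rightarrow> real"
  where "dist_hinf f g = norm (f - g)"

definition sgn_hinf :: "'a hinf \<Rightarrow> 'a hinf"
  where "sgn_hinf f = inverse (norm f) *\<^sub>R f"

definition uniformity_hinf :: "('a hinf \<times> 'a hinf) filter"
  where "uniformity_hinf = (INF e\<in>{0<..}. principal {(f, g). dist f g < e})"

definition open_hinf :: "'a hinf set \<Rightarrow> bool"
  where "open_hinf U = (\<forall>f\<in>U. \<forall>\<^sub>F (f', g) in uniformity. f' = f \<longrightarrow> g \<in> U)"

lemma bdd_hinf: "bdd_above ((\<lambda>x. cmod (hinf_apply f x)) ` ball 0 1)"
  using hinf_apply[of f] by (auto simp: bounded_iff bdd_above_def)

lemma norm_hinf_upper: "x \<in> ball 0 1 \<Longrightarrow> cmod (hinf_apply f x) \<le> norm f"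
  unfolding norm_hinf_def by (rule cSUP_upper[OF _ bdd_hinf])

lemma norm_hinf_least: "(\<And>x. x \<in> ball 0 1 \<Longrightarrow> cmod (hinf_apply f x) \<le> M) \<Longrightarrow> norm f \<le> M"
  unfolding norm_hinf_def by (rule cSUP_least) auto

lemma norm_hinf_scaleC: "norm (c *\<^sub>C f) = cmod c * norm (f :: 'a hinf)"
proof -
  have le: "norm (c *\<^sub>C f) \<le> cmod c * norm f" for c and f :: "'a hinf"
    by (rule norm_hinf_least)
      (simp add: scaleC_hinf.rep_eq norm_mult mult_left_mono norm_hinf_upper del: mem_ball mem_ball_0)
  show ?thesis
  proof (cases "c = 0")
    case True
    have "0 \<le> norm (c *\<^sub>C f)"
      using norm_hinf_upper[of 0 "c *\<^sub>C f"] norm_ge_zero[of "hinf_apply (c *\<^sub>C f) 0"]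
      by (simp del: norm_ge_zero)
    with le[of c f] True show ?thesis by simp
  next
    case False
    have "f = inverse c *\<^sub>C (c *\<^sub>C f)"
      by (rule hinf_ext) (simp add: scaleC_hinf.rep_eq False)
    then have "norm f \<le> inverse (cmod c) * norm (c *\<^sub>C f)"
      using le[of "inverse c" "c *\<^sub>C f"] by (simp add: norm_inverse)
    then have "cmod c * norm f \<le> norm (c *\<^sub>C f)"
      using False by (simp add: field_simps)
    with le[of c f] show ?thesis by simp
  qed
qed

instance
proof
  fix f g h :: "'a hinf" and a b :: real and c d :: complex
  show "f + g + h = f + (g + h)" by transfer (simp add: add.assoc)
  show "f + g = g + f" by transfer (simp add: add.commute)
  show "0 + f = f" by transfer simp
  show "- f + f = 0" unfolding uminus_hinf_def by transfer simp
  show "f - g = f + - g" by (fact minus_hinf_def)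
  show "a *\<^sub>R (f + g) = a *\<^sub>R f + a *\<^sub>R g"
    unfolding scaleR_hinf_def by transfer (simp add: algebra_simps)
  show "(a + b) *\<^sub>R f = a *\<^sub>R f + b *\<^sub>R f"
    unfolding scaleR_hinf_def by transfer (simp add: algebra_simps)
  show "a *\<^sub>R b *\<^sub>R f = (a * b) *\<^sub>R f"
    unfolding scaleR_hinf_def by transfer (simp add: algebra_simps)
  show "1 *\<^sub>R f = f" unfolding scaleR_hinf_def by transfer simp
  show "c *\<^sub>C (f + g) = c *\<^sub>C f + c *\<^sub>C g" by transfer (simp add: algebra_simps)
  show "(c + d) *\<^sub>C f = c *\<^sub>C f + d *\<^sub>C f" by transfer (simp add: algebra_simps)
  show "c *\<^sub>C d *\<^sub>C f = (c * d) *\<^sub>C f" by transfer (simp add: algebra_simps)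
  show "a *\<^sub>R f = complex_of_real a *\<^sub>C f" by (fact scaleR_hinf_def)
  show "norm (c *\<^sub>C f) = cmod c * norm f" by (fact norm_hinf_scaleC)
  show "norm (a *\<^sub>R f) = \<bar>a\<bar> * norm f" by (simp add: scaleR_hinf_def norm_hinf_scaleC)
  show "norm (f + g) \<le> norm f + norm g"
  proof (rule norm_hinf_least)
    fix x :: 'a assume "x \<in> ball 0 1"
    then have "cmod (hinf_apply f x) \<le> norm f" "cmod (hinf_apply g x) \<le> norm g" by (rule norm_hinf_upper)+
    then show "cmod (hinf_apply (f + g) x) \<le> norm f + norm g"
      using norm_triangle_ineq[of "hinf_apply f x" "hinf_apply g x"] by (simp add: plus_hinf.rep_eq)
  qed
  show "(norm f = 0) = (f = 0)"
  proof
    assume "norm f = 0"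
    then show "f = 0"
      using norm_hinf_upper[of _ f] by (intro hinf_ext) (simp add: zero_hinf.rep_eq)
  next
    assume "f = 0"
    then have "f = 0 *\<^sub>C f" by transfer simp
    then show "norm f = 0" using norm_hinf_scaleC[of 0 f] by simp
  qed
qed (simp_all add: dist_hinf_def sgn_hinf_def uniformity_hinf_def open_hinf_def)

end

section \<open>Composition operators\<close>

text \<open>The operator below is determined by its values, and it exists for every holomorphic self-map
  of the ball; both are shown in \<open>comp_op_apply\<close>. For other symbols it is unspecified.\<close>

definition comp_op :: "('a::complex_normed_vector \<Rightarrow> 'a) \<Rightarrow> 'a hinf \<Rightarrow>\<^sub>C\<^sub>L 'a hinf"
  where "comp_op \<psi> =
    (THE T. \<forall>f. \<forall>x\<in>ball 0 1. hinf_apply (cblinfun_apply T f) x = hinf_apply f (\<psi> x))"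

lemma comp_op_apply:
  fixes \<psi> :: "'a::complex_normed_vector \<Rightarrow> 'a"
  assumes hol: "frechet_holomorphic_on \<psi> (ball 0 1)" and self: "\<psi> ` ball 0 1 \<subseteq> ball 0 1"
    and x: "x \<in> ball 0 1"
  shows "hinf_apply (cblinfun_apply (comp_op \<psi>) f) x = hinf_apply f (\<psi> x)"
proof -
  define P where "P = (\<lambda>T :: 'a hinf \<Rightarrow>\<^sub>C\<^sub>L 'a hinf. \<forall>f. \<forall>x\<in>ball 0 1.
      hinf_apply (cblinfun_apply T f) x = hinf_apply f (\<psi> x))"
  define F where "F = (\<lambda>f :: 'a hinf. Abs_hinf (\<lambda>x. if x \<in> ball 0 1 then hinf_apply f (\<psi> x) else 0))"
  have F: "hinf_apply (F f) x = hinf_apply f (\<psi> x)" if "x \<in> ball 0 1" for f x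
  proof -
    let ?g = "\<lambda>x. if x \<in> ball 0 1 then hinf_apply f (\<psi> x) else 0"
    have f: "frechet_holomorphic_on (hinf_apply f) (ball 0 1)" "bounded (hinf_apply f ` ball 0 1)"
      using hinf_apply[of f] by simp_all
    have "frechet_holomorphic_on ?g (ball 0 1)"
      by (rule frechet_holomorphic_on_cong[OF _ frechet_holomorphic_on_compose[OF hol self f(1)]]) auto
    moreover have "bounded (?g ` ball 0 1)"
      by (rule bounded_subset[OF f(2)]) (use self in auto)
    ultimately have "?g \<in> {f. frechet_holomorphic_on f (ball 0 1) \<and> bounded (f ` ball 0 1) \<and>
        (\<forall>x. x \<notin> ball 0 1 \<longrightarrow> f x = 0)}"
      by simp
    from Abs_hinf_inverse[OF this] that show ?thesis
      by (simp add: F_def)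
  qed
  have lin: "bounded_linear F"
  proof (rule bounded_linear_intro[where K = 1])
    fix f g :: "'a hinf" and r :: real
    show "F (f + g) = F f + F g"
      by (rule hinf_ext) (simp add: F plus_hinf.rep_eq del: mem_ball mem_ball_0)
    show "F (r *\<^sub>R f) = r *\<^sub>R F f"
      by (rule hinf_ext) (simp add: F scaleR_scaleC scaleC_hinf.rep_eq del: mem_ball mem_ball_0)
    show "norm (F f) \<le> norm f * 1"
      by (rule norm_hinf_least) (use self in \<open>auto simp: F intro!: norm_hinf_upper\<close>)
  qed
  have "F (c *\<^sub>C f) = c *\<^sub>C F f" for c f
    by (rule hinf_ext) (simp add: F scaleC_hinf.rep_eq del: mem_ball mem_ball_0)
  from ex_cblinfun[OF lin this] obtain T where T: "cblinfun_apply T = F" by blast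
  have PT: "P T" unfolding P_def T using F by blast
  moreover have "S = T" if "P S" for S
    using that PT unfolding P_def by (intro cblinfun_ext hinf_ext) simp
  ultimately have "P (THE T. P T)" by (rule theI)
  moreover have "comp_op \<psi> = (THE T. P T)" by (simp only: comp_op_def P_def)
  ultimately show ?thesis using x by (simp add: P_def)
qed

end

theory Submission
  imports Defs "HOL-Complex_Analysis.Conformal_Mappings"
begin

text \<open>
  Everything follows from one contraction estimate. A bounded holomorphic function \<open>g\<close> on the unit
  ball with \<open>g 0 = 0\<close> satisfies \<open>cmod (g x) \<le> norm g * norm x\<close>: this is the classical Schwarz lemma
  on the complex line through \<open>x\<close>. Since \<open>\<phi>\<close> takes values in the ball of radius \<open>r\<close>, composing with
  \<open>\<phi>\<close> shrinks the norm of \<open>g\<close> by the factor \<open>r\<close>; and since \<open>\<phi>\<close> fixes \<open>0\<close>, the composite vanishes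
  at \<open>0\<close> again, so the estimate iterates: the \<open>n\<close>-th power of the composition operator has norm at
  most \<open>r ^ n\<close> on the functions that vanish at \<open>0\<close>
  (\<open>norm_comp_op_le_of_zero_at_0\<close>). The point of working with \<open>g\<close> rather than with \<open>\<phi>\<close> is that \<open>g\<close> is
  scalar-valued, so that the one-variable Schwarz lemma applies as it stands.

  An arbitrary \<open>f\<close> differs from the constant \<open>f 0\<close> by a function of norm at most \<open>2 * norm f\<close> that
  vanishes at \<open>0\<close>, and constants are fixed by every composition operator. Hence the \<open>n\<close>-th power is
  within \<open>2 * r ^ n\<close> of evaluation at \<open>0\<close> in operator norm. This bound is summable, so the means
  approach the same limit, with an error of order \<open>1 / n\<close>.
\<close>

section \<open>The Schwarz lemma on the unit ball\<close>

lemma frechet_holomorphic_on_complex_line: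
  "frechet_holomorphic_on (\<lambda>z. z *\<^sub>C (u::'a::complex_normed_vector)) S"
proof (rule frechet_holomorphic_onI[of _ _ "\<lambda>_ z. z *\<^sub>C u"])
  fix z c v :: complex
  have "bounded_linear (\<lambda>z. z *\<^sub>C u)"
    by (rule bounded_linear_intro[where K = "norm u"])
      (simp_all add: scaleC_add_left scaleR_scaleC scaleC_scaleC norm_scaleC)
  then show "((\<lambda>z. z *\<^sub>C u) has_derivative (\<lambda>z. z *\<^sub>C u)) (at z)"
    by (rule bounded_linear_imp_has_derivative)
  show "(c *\<^sub>C v) *\<^sub>C u = c *\<^sub>C v *\<^sub>C u"
    by (simp add: scaleC_scaleC)
qed

lemma hinf_Schwarz:
  assumes g0: "hinf_apply g 0 = 0" and x: "x \<in> ball 0 1"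
  shows "cmod (hinf_apply g x) \<le> norm g * norm x"
proof (cases "x = 0")
  case True
  then show ?thesis by (simp add: g0)
next
  case False
  define u where "u = complex_of_real (inverse (norm x)) *\<^sub>C x"
  have norm_u: "norm u = 1"
    using False by (simp add: u_def norm_scaleC norm_inverse)
  have x_eq: "complex_of_real (norm x) *\<^sub>C u = x"
    using False scaleR_scaleC[of 1 x] by (simp add: u_def scaleC_scaleC)
  have line: "(\<lambda>z. z *\<^sub>C u) ` ball 0 1 \<subseteq> ball 0 1"
    by (auto simp: norm_scaleC norm_u)
  have "frechet_holomorphic_on (hinf_apply g) (ball 0 1)"
    using hinf_apply[of g] by simp
  then have hol: "(\<lambda>z. hinf_apply g (z *\<^sub>C u)) holomorphic_on ball 0 1"
    using frechet_holomorphic_on_compose[OF frechet_holomorphic_on_complex_line line]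
    by (simp add: frechet_holomorphic_on_complex_iff[symmetric])
  \<comment> \<open>The scalar Schwarz lemma asks for values strictly inside the unit disc, whence the division by
    a number above the norm of \<open>g\<close>.\<close>
  have bound: "cmod (hinf_apply g x) \<le> M * norm x" if M: "norm g < M" for M
  proof -
    have M0: "0 < M" using M norm_ge_zero[of g] by linarith
    let ?h = "\<lambda>z. hinf_apply g (z *\<^sub>C u) / complex_of_real M"
    have "cmod (?h (complex_of_real (norm x))) \<le> cmod (complex_of_real (norm x))"
    proof (rule Schwarz_Lemma(1))
      show "?h holomorphic_on ball 0 1"
        using hol M0 by (intro holomorphic_intros) auto
      show "?h 0 = 0"
        using norm_scaleC[of 0 u] by (simp add: g0)
      show "cmod (?h z) < 1" if "cmod z < 1" for z
      proof -
        have "z *\<^sub>C u \<in> ball 0 1" using that by (simp add: norm_scaleC norm_u)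
        then have "cmod (hinf_apply g (z *\<^sub>C u)) < M"
          using norm_hinf_upper[of "z *\<^sub>C u" g] M by linarith
        then show ?thesis using M0 by (simp add: norm_divide)
      qed
      show "cmod (complex_of_real (norm x)) < 1" using x by simp
    qed
    then show ?thesis
      using M0 by (simp add: x_eq norm_divide field_simps)
  qed
  have "cmod (hinf_apply g x) / norm x \<le> M" if "norm g < M" for M
    using bound[OF that] False by (simp add: divide_simps)
  then have "cmod (hinf_apply g x) / norm x \<le> norm g"
    by (rule dense_ge)
  then show ?thesis using False by (simp add: divide_simps)
qed

section \<open>Powers of a composition operator\<close>

lemma hinf_apply_diff: "hinf_apply (f - g) x = hinf_apply f x - hinf_apply g x"
  by (simp add: minus_hinf_def uminus_hinf_def plus_hinf.rep_eq scaleC_hinf.rep_eq)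

lemma cblinfun_apply_diff: "cblinfun_apply (S - T) x = cblinfun_apply S x - cblinfun_apply T x"
  by (simp add: cblinfun_apply_def minus_cblinfun.rep_eq blinfun.diff_left)

lemma norm_cblinfun_le:
  assumes "0 \<le> M" and "\<And>x. norm (cblinfun_apply T x) \<le> M * norm x"
  shows "norm T \<le> M"
  unfolding norm_cblinfun_onorm using assms by (rule onorm_bound)

lemma hinf_apply_comp_op_const:
  assumes "c \<in> ball 0 1" and "x \<in> ball 0 1"
  shows "hinf_apply (cblinfun_apply (comp_op (\<lambda>_. c)) f) x = hinf_apply f c"
  using assms by (intro comp_op_apply frechet_holomorphic_on_const) auto

lemma holomorphic_self_map_funpow:
  assumes "frechet_holomorphic_on \<phi> S" and "\<phi> ` S \<subseteq> S"
  shows "frechet_holomorphic_on (\<phi> ^^ n) S \<and> (\<phi> ^^ n) ` S \<subseteq> S"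
proof (induction n)
  case 0
  have "frechet_holomorphic_on (\<lambda>x. x) S"
    by (rule frechet_holomorphic_onI[of _ _ "\<lambda>_ v. v"]) simp_all
  then show ?case by (simp add: id_def)
next
  case (Suc n)
  then have "frechet_holomorphic_on (\<lambda>x. \<phi> ((\<phi> ^^ n) x)) S"
    using assms(1) frechet_holomorphic_on_compose by blast
  moreover have "(\<phi> ^^ Suc n) ` S \<subseteq> S" using Suc assms(2) by auto
  ultimately show ?case by (simp add: o_def)
qed

lemma comp_op_funpow:
  assumes hol: "frechet_holomorphic_on \<phi> (ball 0 1)" and self: "\<phi> ` ball 0 1 \<subseteq> ball 0 1"
  shows "comp_op (\<phi> ^^ n) = cblinfun_power (comp_op \<phi>) n"
proof (rule cblinfun_ext, rule hinf_ext)
  fix f and x :: 'a assume x: "x \<in> ball 0 1"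
  have "hinf_apply ((cblinfun_apply (comp_op \<phi>) ^^ n) f) x = hinf_apply f ((\<phi> ^^ n) x)"
    using x
  proof (induction n arbitrary: x)
    case (Suc n)
    have "\<phi> x \<in> ball 0 1" using Suc.prems self by blast
    from Suc.IH[OF this] show ?case
      by (simp add: comp_op_apply[OF hol self Suc.prems] funpow_swap1[of \<phi>])
  qed simp
  moreover have "hinf_apply (cblinfun_apply (comp_op (\<phi> ^^ n)) f) x = hinf_apply f ((\<phi> ^^ n) x)"
    using holomorphic_self_map_funpow[OF hol self, of n] x by (intro comp_op_apply) blast+
  ultimately show "hinf_apply (cblinfun_apply (comp_op (\<phi> ^^ n)) f) x =
      hinf_apply (cblinfun_apply (cblinfun_power (comp_op \<phi>) n) f) x"
    by (simp only: cblinfun_power_apply)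
qed

text \<open>The estimate and the vanishing at \<open>0\<close> are proved together, because the next step of the
  iteration needs both.\<close>

lemma norm_comp_op_le_of_zero_at_0:
  assumes hol: "frechet_holomorphic_on \<phi> (ball 0 1)" and self: "\<phi> ` ball 0 1 \<subseteq> ball 0 1"
    and r: "\<And>x. x \<in> ball 0 1 \<Longrightarrow> norm (\<phi> x) \<le> r" and \<phi>0: "\<phi> 0 = 0"
    and g0: "hinf_apply g 0 = 0"
  shows "hinf_apply ((cblinfun_apply (comp_op \<phi>) ^^ n) g) 0 = 0 \<and>
    norm ((cblinfun_apply (comp_op \<phi>) ^^ n) g) \<le> r ^ n * norm g"
proof (induction n)
  case 0
  then show ?case by (simp add: g0)
next
  case (Suc n)
  define h where "h = (cblinfun_apply (comp_op \<phi>) ^^ n) g"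
  have h: "hinf_apply h 0 = 0" "norm h \<le> r ^ n * norm g"
    using Suc by (simp_all add: h_def)
  have r0: "0 \<le> r" using r[of 0] by (simp add: \<phi>0)
  have "norm (cblinfun_apply (comp_op \<phi>) h) \<le> norm h * r"
  proof (rule norm_hinf_least)
    fix x :: 'a assume x: "x \<in> ball 0 1"
    have "cmod (hinf_apply h (\<phi> x)) \<le> norm h * norm (\<phi> x)"
      using hinf_Schwarz[OF h(1)] x self by blast
    also have "\<dots> \<le> norm h * r"
      by (rule mult_left_mono[OF r[OF x] norm_ge_zero])
    finally show "cmod (hinf_apply (cblinfun_apply (comp_op \<phi>) h) x) \<le> norm h * r"
      by (simp add: comp_op_apply[OF hol self x])
  qed
  also have "\<dots> \<le> r ^ Suc n * norm g"
    using mult_right_mono[OF h(2) r0] by (simp add: mult_ac)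
  finally show ?case
    using h(1) comp_op_apply[OF hol self, of 0 h] by (simp add: h_def[symmetric] \<phi>0)
qed

text \<open>Since the constant function with value \<open>f 0\<close> is a fixed point of the powers, the difference of
  the two operators at \<open>f\<close> is the power applied to \<open>f\<close> minus that constant, which vanishes at \<open>0\<close>.
  The factor \<open>2\<close> is the price of subtracting the constant.\<close>

lemma norm_comp_op_power_diff_le:
  assumes hol: "frechet_holomorphic_on \<phi> (ball 0 1)" and self: "\<phi> ` ball 0 1 \<subseteq> ball 0 1"
    and r: "\<And>x. x \<in> ball 0 1 \<Longrightarrow> norm (\<phi> x) \<le> r" and \<phi>0: "\<phi> 0 = 0"
  shows "norm (cblinfun_power (comp_op \<phi>) n - comp_op (\<lambda>_. 0)) \<le> 2 * r ^ n"
proof (rule norm_cblinfun_le)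
  have "0 \<le> r" using r[of 0] by (simp add: \<phi>0)
  then show "0 \<le> 2 * r ^ n" by simp
  fix f :: "'a hinf"
  define T where "T = cblinfun_power (comp_op \<phi>) n"
  define c where "c = cblinfun_apply (comp_op (\<lambda>_. 0)) f"
  have c: "hinf_apply c x = hinf_apply f 0" if "x \<in> ball 0 1" for x
    unfolding c_def using that by (intro hinf_apply_comp_op_const) simp_all
  have T: "hinf_apply (cblinfun_apply T h) x = hinf_apply h ((\<phi> ^^ n) x)" "(\<phi> ^^ n) x \<in> ball 0 1"
    if "x \<in> ball 0 1" for h x
    using that holomorphic_self_map_funpow[OF hol self, of n]
    by (auto simp: T_def comp_op_funpow[OF hol self, symmetric] comp_op_apply simp del: mem_ball mem_ball_0)
  have "cblinfun_apply (T - comp_op (\<lambda>_. 0)) f = cblinfun_apply T (f - c)"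
    by (rule hinf_ext)
      (simp add: cblinfun_apply_diff c_def[symmetric] hinf_apply_diff c T del: mem_ball mem_ball_0)
  also have "norm \<dots> \<le> r ^ n * norm (f - c)"
    using norm_comp_op_le_of_zero_at_0[OF hol self r \<phi>0, of "f - c" n]
    by (simp add: T_def cblinfun_power_apply hinf_apply_diff c)
  also have "r ^ n * norm (f - c) \<le> r ^ n * (2 * norm f)"
  proof (rule mult_left_mono)
    have "norm c \<le> norm f"
      by (rule norm_hinf_least) (use norm_hinf_upper[of 0 f] in \<open>simp add: c del: mem_ball\<close>)
    then show "norm (f - c) \<le> 2 * norm f" using norm_triangle_ineq4[of f c] by linarith
    show "0 \<le> r ^ n" using \<open>0 \<le> r\<close> by simp
  qed
  finally show "norm (cblinfun_apply (cblinfun_power (comp_op \<phi>) n - comp_op (\<lambda>_. 0)) f)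
      \<le> 2 * r ^ n * norm f"
    by (simp add: T_def mult_ac)
qed

section \<open>Convergence of the powers and of their means\<close>

text \<open>The error of the mean is the mean of the errors, and the sum of the errors stays below the sum of
  the whole series while the divisor \<open>n\<close> grows.\<close>

lemma cesaro_mean_tendsto:
  assumes le: "\<And>k. norm (cblinfun_power T k - P) \<le> a k" and "summable a"
  shows "cesaro_mean T \<longlonglongrightarrow> P"
proof (rule Lim_null[THEN iffD2], rule Lim_null_comparison)
  show "(\<lambda>n. suminf a / real n) \<longlonglongrightarrow> 0"
    by (rule lim_const_over_n)
  have "norm (cesaro_mean T n - P) \<le> suminf a / real n" if n: "n > 0" for n
  proof -
    have P: "(1 / real n) *\<^sub>R (\<Sum>k<n. P) = P"
      using n by (simp add: sum_constant_scaleR)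
    have "cesaro_mean T n - P = (1 / real n) *\<^sub>R (\<Sum>k<n. cblinfun_power T k - P)"
      by (simp only: cesaro_mean_def sum_subtractf scaleR_diff_right P)
    also have "norm \<dots> = norm (\<Sum>k<n. cblinfun_power T k - P) / real n"
      by simp
    also have "\<dots> \<le> suminf a / real n"
    proof (rule divide_right_mono)
      have "norm (\<Sum>k<n. cblinfun_power T k - P) \<le> (\<Sum>k<n. a k)"
        by (rule sum_norm_le) (rule le)
      also have "\<dots> \<le> suminf a"
        by (rule sum_le_suminf[OF assms(2)]) (auto intro: order_trans[OF norm_ge_zero le])
      finally show "norm (\<Sum>k<n. cblinfun_power T k - P) \<le> suminf a" .
    qed simp
    finally show ?thesis .
  qed
  then show "\<forall>\<^sub>F n in sequentially. norm (cesaro_mean T n - P) \<le> suminf a / real n"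
    by (rule eventually_mono[OF eventually_gt_at_top[of 0]])
qed

theorem proposition6p1:
  fixes \<phi> :: "'a::complex_banach \<Rightarrow> 'a" and r :: real
  assumes "frechet_holomorphic_on \<phi> (ball 0 1)"
    and "\<phi> ` ball 0 1 \<subseteq> ball 0 1"
    and "0 < r" and "r < 1"
    and "\<phi> ` ball 0 1 \<subseteq> (*\<^sub>R) r ` ball 0 1"
    and "\<phi> 0 = 0"
  shows "((\<lambda>n. comp_op (\<phi> ^^ n)) \<longlonglongrightarrow> comp_op (\<lambda>_. 0)) \<and>
    (cesaro_mean (comp_op \<phi>) \<longlonglongrightarrow> comp_op (\<lambda>_. 0)) \<and>
    uniformly_mean_ergodic (comp_op \<phi>)"
proof -
  have "norm (\<phi> x) \<le> r" if "x \<in> ball 0 1" for x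
  proof -
    have "\<phi> x \<in> (*\<^sub>R) r ` ball 0 1"
      using assms(5) imageI[OF that] by (rule subsetD)
    then obtain y where "\<phi> x = r *\<^sub>R y" "y \<in> ball 0 1"
      by (rule imageE)
    then show ?thesis using \<open>0 < r\<close> mult_left_mono[of "norm y" 1 r] by simp
  qed
  then have le: "norm (cblinfun_power (comp_op \<phi>) n - comp_op (\<lambda>_. 0)) \<le> 2 * r ^ n" for n
    using norm_comp_op_power_diff_le[OF assms(1,2) _ assms(6)] by blast
  have sum: "summable (\<lambda>n. 2 * r ^ n)"
    using assms(3,4) by (intro summable_mult summable_geometric) simp
  have "(\<lambda>n. cblinfun_power (comp_op \<phi>) n) \<longlonglongrightarrow> comp_op (\<lambda>_. 0)"
    by (rule Lim_null[THEN iffD2], rule Lim_null_comparison[OF _ summable_LIMSEQ_zero[OF sum]])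
      (simp add: le)
  moreover have "cesaro_mean (comp_op \<phi>) \<longlonglongrightarrow> comp_op (\<lambda>_. 0)"
    using le sum by (rule cesaro_mean_tendsto)
  ultimately show ?thesis
    by (auto simp: comp_op_funpow[OF assms(1,2)] uniformly_mean_ergodic_def convergent_def)
qed

end
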